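(* Let $\alpha,\beta\in BV[a,b]$ and let $S$ be the set of common discontinuities of $\alpha$ and $\beta$. Then $$\int_a^b\alpha(x)\,d\beta+\int_a^b\beta(x)\,d\alpha=\alpha(b)\beta(b)-\alpha(a)\beta(a)+\sum_{t\in S}A_{\alpha,\beta}(t),$$ where the integrals are RDS integrals and $$A_{\alpha,\beta}(t)=\Big[\alpha(t)-\tfrac12(\alpha(t+)+\alpha(t-))\Big]\mu_\beta(\{t\})+\Big[\beta(t)-\tfrac12(\beta(t+)+\beta(t-))\Big]\mu_\alpha(\{t\}).$$
   Context: Fix reals $a<b$. $B[a,b]$, $I[a,b]$, $BV[a,b]$ denote the bounded, the increasing (nondecreasing), and the bounded-variation real functions on $[a,b]$. $\alpha(x\pm)$ are one-sided limits, with the convention $\alpha(a-)=\alpha(a)$, $\alpha(b+)=\alpha(b)$. A partition is $\mathcal P=\{x_i\}_{i=0}^n$ with $a=x_0<\dots<x_n=b$; $I_i=(x_{i-1},x_i)$. Set $\mu_\alpha((c,d))=\alpha(d-)-\alpha(c+)$ and $\mu_\alpha(\{c\})=\alpha(c+)-\alpha(c-)$. A step function $u\in S[a,b]$ is a bounded function which, for some partition, equals a constant $c_i$ on each $I_i$ (values at partition points arbitrary); its integral is $\int_a^b u\,d\alpha=\sum_{i=0}^n u(x_i)\mu_\alpha(\{x_i\})+\sum_{i=1}^n c_i\mu_\alpha(I_i)$ (independent of the partition). RDS integral: for $\alpha\in I[a,b]$, $f\in B[a,b]$, let $L_\alpha(f,[a,b])=\sup\{\int_a^b v\,d\alpha: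 v\in S[a,b], v\le f\}$ and $U_\alpha(f,[a,b])=\inf\{\int_a^b u\,d\alpha: u\in S[a,b], u\ge f\}$. Write $f\in RDS_\alpha[a,b]$ if these are equal; the common value is $\int_a^b f(x)\,d\alpha$. For $\alpha\in BV[a,b]$, $f\in RDS_\alpha[a,b]$ if there is a decomposition $\alpha=\alpha^+-\alpha^-$ with $\alpha^\pm\in I[a,b]$ and $f\in RDS_{\alpha^+}[a,b]\cap RDS_{\alpha^-}[a,b]$; then $\int_a^b f\,d\alpha=\int_a^b f\,d\alpha^+-\int_a^b f\,d\alpha^-$ (independent of the decomposition). It is known that $f\in RDS_\alpha[a,b]$ whenever $f,\alpha\in BV[a,b]$, so both integrals in the claim exist. *)

theory Defs
  imports "HOL-Analysis.Analysis"
begin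

text \<open>
  Functions on \<open>[a,b]\<close> are represented by functions on the whole real line; the notions below
  depend only on their values in \<open>{a..b}\<close>.
\<close>

definition is_partition :: "real \<Rightarrow> real \<Rightarrow> nat \<Rightarrow> (nat \<Rightarrow> real) \<Rightarrow> bool" where
  "is_partition a b n x \<longleftrightarrow> x 0 = a \<and> x n = b \<and> (\<forall>i<n. x i < x (Suc i))"

definition bounded_variation_on :: "real \<Rightarrow> real \<Rightarrow> (real \<Rightarrow> real) \<Rightarrow> bool" where
  "bounded_variation_on a b \<alpha> \<longleftrightarrow>
     (\<exists>M. \<forall>n x. is_partition a b n x \<longrightarrow> (\<Sum>i<n. \<bar>\<alpha> (x (Suc i)) - \<alpha> (x i)\<bar>) \<le> M)"

text \<open>
  One-sided limits, with the convention that the left limit at \<open>a\<close> is \<open>\<alpha> a\<close> and the right limit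
  at \<open>b\<close> is \<open>\<alpha> b\<close>.
\<close>

definition left_lim :: "real \<Rightarrow> (real \<Rightarrow> real) \<Rightarrow> real \<Rightarrow> real" where
  "left_lim a \<alpha> t = (if t = a then \<alpha> a else Lim (at_left t) \<alpha>)"

definition right_lim :: "real \<Rightarrow> (real \<Rightarrow> real) \<Rightarrow> real \<Rightarrow> real" where
  "right_lim b \<alpha> t = (if t = b then \<alpha> b else Lim (at_right t) \<alpha>)"

definition mu_point :: "real \<Rightarrow> real \<Rightarrow> (real \<Rightarrow> real) \<Rightarrow> real \<Rightarrow> real" where
  "mu_point a b \<alpha> c = right_lim b \<alpha> c - left_lim a \<alpha> c"

definition mu_open :: "real \<Rightarrow> real \<Rightarrow> (real \<Rightarrow> real) \<Rightarrow> real \<Rightarrow> real \<Rightarrow> real" where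
  "mu_open a b \<alpha> c d = left_lim a \<alpha> d - right_lim b \<alpha> c"

text \<open>
  \<open>step_repr a b n x c u\<close>: on each open interval of the partition \<open>x\<close>, the function \<open>u\<close> is equal to
  the constant \<open>c i\<close>, where \<open>i\<close> is the index of the right endpoint.
\<close>

definition step_repr ::
  "real \<Rightarrow> real \<Rightarrow> nat \<Rightarrow> (nat \<Rightarrow> real) \<Rightarrow> (nat \<Rightarrow> real) \<Rightarrow> (real \<Rightarrow> real) \<Rightarrow> bool" where
  "step_repr a b n x c u \<longleftrightarrow>
     is_partition a b n x \<and> (\<forall>i\<in>{1..n}. \<forall>t\<in>{x (i - 1)<..<x i}. u t = c i)"

definition step_function :: "real \<Rightarrow> real \<Rightarrow> (real \<Rightarrow> real) \<Rightarrow> bool" where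
  "step_function a b u \<longleftrightarrow> bounded (u ` {a..b}) \<and> (\<exists>n x c. step_repr a b n x c u)"

definition step_integral :: "real \<Rightarrow> real \<Rightarrow> (real \<Rightarrow> real) \<Rightarrow> (real \<Rightarrow> real) \<Rightarrow> real" where
  "step_integral a b \<alpha> u =
     (THE I. \<exists>n x c. step_repr a b n x c u \<and>
        I = (\<Sum>i=0..n. u (x i) * mu_point a b \<alpha> (x i)) +
            (\<Sum>i=1..n. c i * mu_open a b \<alpha> (x (i - 1)) (x i)))"

definition RDS_lower :: "real \<Rightarrow> real \<Rightarrow> (real \<Rightarrow> real) \<Rightarrow> (real \<Rightarrow> real) \<Rightarrow> real" where
  "RDS_lower a b \<alpha> f =
     Sup {step_integral a b \<alpha> v |v. step_function a b v \<and> (\<forall>t\<in>{a..b}. v t \<le> f t)}"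

definition RDS_upper :: "real \<Rightarrow> real \<Rightarrow> (real \<Rightarrow> real) \<Rightarrow> (real \<Rightarrow> real) \<Rightarrow> real" where
  "RDS_upper a b \<alpha> f =
     Inf {step_integral a b \<alpha> u |u. step_function a b u \<and> (\<forall>t\<in>{a..b}. f t \<le> u t)}"

definition RDS_integrable_inc :: "real \<Rightarrow> real \<Rightarrow> (real \<Rightarrow> real) \<Rightarrow> (real \<Rightarrow> real) \<Rightarrow> bool" where
  "RDS_integrable_inc a b \<alpha> f \<longleftrightarrow>
     mono_on {a..b} \<alpha> \<and> bounded (f ` {a..b}) \<and> RDS_lower a b \<alpha> f = RDS_upper a b \<alpha> f"

definition RDS_integral_inc :: "real \<Rightarrow> real \<Rightarrow> (real \<Rightarrow> real) \<Rightarrow> (real \<Rightarrow> real) \<Rightarrow> real" where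
  "RDS_integral_inc a b \<alpha> f = RDS_lower a b \<alpha> f"

definition RDS_decomp ::
  "real \<Rightarrow> real \<Rightarrow> (real \<Rightarrow> real) \<Rightarrow> (real \<Rightarrow> real) \<Rightarrow> (real \<Rightarrow> real) \<Rightarrow> (real \<Rightarrow> real) \<Rightarrow> bool" where
  "RDS_decomp a b \<alpha> f \<alpha>p \<alpha>m \<longleftrightarrow>
     (\<forall>t\<in>{a..b}. \<alpha> t = \<alpha>p t - \<alpha>m t) \<and>
     RDS_integrable_inc a b \<alpha>p f \<and> RDS_integrable_inc a b \<alpha>m f"

definition RDS_integrable :: "real \<Rightarrow> real \<Rightarrow> (real \<Rightarrow> real) \<Rightarrow> (real \<Rightarrow> real) \<Rightarrow> bool" where
  "RDS_integrable a b \<alpha> f \<longleftrightarrow>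
     bounded_variation_on a b \<alpha> \<and> (\<exists>\<alpha>p \<alpha>m. RDS_decomp a b \<alpha> f \<alpha>p \<alpha>m)"

text \<open>The integral of \<open>f\<close> with respect to \<open>\<alpha>\<close>; the integrator comes first.\<close>

definition RDS_integral :: "real \<Rightarrow> real \<Rightarrow> (real \<Rightarrow> real) \<Rightarrow> (real \<Rightarrow> real) \<Rightarrow> real" where
  "RDS_integral a b \<alpha> f =
     (THE I. \<exists>\<alpha>p \<alpha>m. RDS_decomp a b \<alpha> f \<alpha>p \<alpha>m \<and>
        I = RDS_integral_inc a b \<alpha>p f - RDS_integral_inc a b \<alpha>m f)"

definition common_discontinuities ::
  "real \<Rightarrow> real \<Rightarrow> (real \<Rightarrow> real) \<Rightarrow> (real \<Rightarrow> real) \<Rightarrow> real set" where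
  "common_discontinuities a b \<alpha> \<beta> =
     {t\<in>{a..b}. \<not> continuous (at t within {a..b}) \<alpha> \<and> \<not> continuous (at t within {a..b}) \<beta>}"

definition parts_correction ::
  "real \<Rightarrow> real \<Rightarrow> (real \<Rightarrow> real) \<Rightarrow> (real \<Rightarrow> real) \<Rightarrow> real \<Rightarrow> real" where
  "parts_correction a b \<alpha> \<beta> t =
     (\<alpha> t - 1/2 * (right_lim b \<alpha> t + left_lim a \<alpha> t)) * mu_point a b \<beta> t +
     (\<beta> t - 1/2 * (right_lim b \<beta> t + left_lim a \<beta> t)) * mu_point a b \<alpha> t"

end

theory Submission
  imports Defs
begin

text \<open>
  Off a suitable finite set, both functions oscillate by at most \<open>\<epsilon>\<close>. On a partition containing that
  set, replace each integrand by the step function that agrees with it at the partition points and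
  on each open interval takes the mean of its one-sided limits at the two ends. This changes the two
  integrals by \<open>O(\<epsilon>)\<close>, and the sum of the two step integrals is exactly the boundary term plus the sum
  of the correction terms over the partition points. A correction term vanishes outside the common
  discontinuities, and refining the partition by arbitrary further points is harmless, so this
  estimate is the convergence of the unordered sum.
\<close>

subsection \<open>One-sided limits\<close>

text \<open>One estimate carries the analysis: if a step function stays within \<epsilon> of the
  integrand on [a,b], then for an increasing integrator the lower and the upper integral both lie
  within \<epsilon> times the total increase of the integrator from the step integral.
  Integrability, independence of the decomposition and the final error bound are all read off from
  it. The obstacle before it is that \<open>step_integral\<close> and \<open>RDS_integral\<close>
  are definite descriptions and say nothing until uniqueness is known. For the first, all
  representations of a step function are compared with one integral against a Stieltjes measure; for
  the second, any two decompositions are compared with the same step sum. The factor 1/2 in the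
  correction term and the means on the open intervals have one origin. If both functions took at t
  the means of their one-sided limits, the point t would contribute exactly the jump of the product
  \<alpha> \<beta>; the correction records how far their actual values depart from these means. On
  an open interval the values of the step functions are free up to \<epsilon>, so the means can be
  chosen there and no correction remains.\<close>

definition sided_limits :: "(real \<Rightarrow> real) \<Rightarrow> bool" where
  "sided_limits e \<longleftrightarrow> (\<forall>t. (\<exists>l. (e \<longlongrightarrow> l) (at_left t)) \<and> (\<exists>r. (e \<longlongrightarrow> r) (at_right t)))"

lemma mono_tendsto_at_right:
  fixes e :: "real \<Rightarrow> real"
  assumes "mono e"
  shows "(e \<longlongrightarrow> (INF s\<in>{t<..}. e s)) (at_right t)"
  using Lim_right_bound[of UNIV t e "e t"] assms by (auto simp: mono_def)

lemma mono_tendsto_at_left: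
  fixes e :: "real \<Rightarrow> real"
  assumes "mono e"
  shows "(e \<longlongrightarrow> (SUP s\<in>{..<t}. e s)) (at_left t)"
  using Lim_left_bound[of UNIV t e "e t"] assms by (auto simp: mono_def)

lemma mono_sided_limits: "mono e \<Longrightarrow> sided_limits e"
  unfolding sided_limits_def using mono_tendsto_at_right mono_tendsto_at_left by blast

lemma sided_limits_diff:
  assumes "sided_limits e" "sided_limits e'"
  shows "sided_limits (\<lambda>t. e t - e' t)"
  using assms unfolding sided_limits_def by (blast intro: tendsto_diff)

subsection \<open>Stieltjes measure of a monotone function\<close>

text \<open>\<open>interval_measure\<close> wants a right-continuous generator, so \<open>e\<close>
  is replaced by its right-limit function \<open>G\<close>. This changes \<open>e\<close> only at
  its jumps, and the masses of points and open intervals see nothing but one-sided limits, which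
  \<open>e\<close> and \<open>G\<close> share.\<close>

lemma stieltjes_measure_exists:
  fixes e :: "real \<Rightarrow> real"
  assumes e: "mono e"
  obtains M where "sets M = sets borel"
    and "\<And>c d p q. c < d \<Longrightarrow> (e \<longlongrightarrow> p) (at_right c) \<Longrightarrow> (e \<longlongrightarrow> q) (at_left d)
           \<Longrightarrow> emeasure M {c<..<d} = ennreal (q - p)"
    and "\<And>c p q. (e \<longlongrightarrow> p) (at_left c) \<Longrightarrow> (e \<longlongrightarrow> q) (at_right c) \<Longrightarrow> emeasure M {c} = ennreal (q - p)"
proof -
  define G where "G t = (INF s\<in>{t<..}. e s)" for t
  have GI: "(e \<longlongrightarrow> G t) (at_right t)" for t
    unfolding G_def by (rule mono_tendsto_at_right[OF e])
  have bdd: "bdd_below (e ` {t<..})" for t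
    using monoD[OF e] by (intro bdd_belowI2[of _ "e t"]) auto
  have G_le: "G s \<le> e t" if "s < t" for s t
    unfolding G_def using that bdd by (intro cINF_lower) auto
  have G_ge: "e t \<le> G t" for t
    unfolding G_def using monoD[OF e] by (intro cINF_greatest) auto
  have G_mono: "G s \<le> G t" if "s \<le> t" for s t
    using that G_le G_ge by (cases "s = t") (auto intro: order_trans[of _ "e t"])
  have G_cont: "continuous (at_right t) G" for t
    unfolding continuous_within
  proof (rule order_tendstoI)
    fix y assume "y < G t"
    moreover have "G t \<le> G s" if "t < s" for s using that G_mono by simp
    ultimately show "\<forall>\<^sub>F s in at_right t. y < G s"
      by (intro eventually_at_rightI[of t "t+1"]) (auto intro: less_le_trans)
  next
    fix y assume "G t < y"
    then have "\<forall>\<^sub>F s in at_right t. e s < y"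
      using GI order_tendstoD(2) by blast
    then obtain d where d: "t < d" "\<And>s. t < s \<Longrightarrow> s < d \<Longrightarrow> e s < y"
      unfolding eventually_at_right_field by blast
    show "\<forall>\<^sub>F s in at_right t. G s < y"
    proof (rule eventually_at_rightI[of t d])
      fix s assume s: "s \<in> {t<..<d}"
      then have "G s \<le> e ((s + d) / 2)" by (intro G_le) auto
      also have "\<dots> < y" using s by (intro d) auto
      finally show "G s < y" .
    qed (use d in auto)
  qed
  define M where "M = interval_measure G"
  have Ioc: "emeasure M {c<..d} = ennreal (G d - G c)" if "c \<le> d" for c d
    unfolding M_def using that G_mono G_cont by (rule emeasure_interval_measure_Ioc)
  have setsM: "sets M = sets borel" by (simp add: M_def)
  have Ioo: "emeasure M {c<..<d} = ennreal (q - G c)" if "c < d" and q: "(e \<longlongrightarrow> q) (at_left d)" for c d q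
  proof -
    \<comment> \<open>Starts at \<open>c\<close> and increases strictly to \<open>d\<close> without
      reaching it.\<close>
    define X where "X n = d - (d - c) / real (Suc n)" for n
    have X: "c \<le> X n" "X n < d" for n
      using that(1) mult_right_mono[of c d "real n"] by (auto simp: X_def field_simps)
    have X_less: "X n < X (Suc n)" for n
      using that(1) unfolding X_def by (intro diff_strict_left_mono divide_strict_left_mono) auto
    then have X_mono: "mono X" by (intro incseq_SucI less_imp_le)
    have "(\<lambda>n. d - (d - c) * inverse (real (Suc n))) \<longlonglongrightarrow> d - (d - c) * 0"
      by (intro tendsto_intros LIMSEQ_inverse_real_of_nat)
    then have X_lim: "X \<longlonglongrightarrow> d" by (simp add: X_def[abs_def] divide_inverse)
    have "filterlim X (at_left d) sequentially"
      unfolding at_within_def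
      using X X_lim by (auto simp: filterlim_inf filterlim_principal)
    then have eX: "(\<lambda>n. e (X n)) \<longlonglongrightarrow> q" by (rule filterlim_compose[OF q])
    \<comment> \<open>Sandwich \<open>e (X n) \<le> G (X n) \<le> e (X (Suc n))\<close>; the second
      inequality needs the strict growth of \<open>X\<close>.\<close>
    have "(\<lambda>n. G (X n)) \<longlonglongrightarrow> q"
      by (rule tendsto_sandwich[OF _ _ eX LIMSEQ_Suc[OF eX]]) (use G_ge G_le X_less in auto)
    then have "(\<lambda>n. ennreal (G (X n) - G c)) \<longlonglongrightarrow> ennreal (q - G c)"
      by (intro tendsto_intros)
    then have 1: "(\<lambda>n. emeasure M {c<..X n}) \<longlonglongrightarrow> ennreal (q - G c)"
      using Ioc X by simp
    have "(\<Union>n. {c<..X n}) = {c<..<d}"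
    proof safe
      fix x assume "x \<in> {c<..<d}"
      then have "\<forall>\<^sub>F n in sequentially. x < X n"
        using X_lim order_tendstoD(1) by auto
      then obtain n where "x < X n" by (auto simp: eventually_sequentially)
      then show "x \<in> (\<Union>n. {c<..X n})" using \<open>x \<in> {c<..<d}\<close> by (auto intro: less_imp_le)
    qed (use X in \<open>auto intro: le_less_trans\<close>)
    moreover have "(\<lambda>n. emeasure M {c<..X n}) \<longlonglongrightarrow> emeasure M (\<Union>n. {c<..X n})"
      using monoD[OF X_mono] setsM by (intro Lim_emeasure_incseq) (force simp: incseq_def)+
    ultimately show ?thesis using 1 LIMSEQ_unique by metis
  qed
  have rlim: "p = G c" if "(e \<longlongrightarrow> p) (at_right c)" for p c
    using tendsto_unique[OF _ that GI] by simp
  show ?thesis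
  proof (rule that[OF setsM])
    show "emeasure M {c<..<d} = ennreal (q - p)"
      if "c < d" "(e \<longlongrightarrow> p) (at_right c)" "(e \<longlongrightarrow> q) (at_left d)" for c d p q
      using Ioo[OF that(1,3)] rlim[OF that(2)] by simp
    show "emeasure M {c} = ennreal (q - p)"
      if p: "(e \<longlongrightarrow> p) (at_left c)" and q: "(e \<longlongrightarrow> q) (at_right c)" for c p q
    proof -
      \<comment> \<open>Makes the subtrahend below nonnegative, so that the difference in
        \<open>ennreal\<close> is the real one. The left end \<open>c - 1\<close> is arbitrary and
        cancels.\<close>
      have "G (c - 1) \<le> p"
        using G_le by (intro tendsto_lowerbound[OF p] eventually_at_leftI[of "c-1"]) auto
      have "{c} = {c-1<..c} - {c-1<..<c}" by auto
      also have "emeasure M \<dots> = emeasure M {c-1<..c} - emeasure M {c-1<..<c}"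
        using Ioo[OF _ p, of "c-1"] setsM by (intro emeasure_Diff) auto
      also have "\<dots> = ennreal (G c - G (c-1)) - ennreal (p - G (c-1))"
        using Ioo[OF _ p, of "c-1"] Ioc by simp
      also have "\<dots> = ennreal (q - p)"
        using \<open>G (c - 1) \<le> p\<close> rlim[OF q] by (simp add: ennreal_minus)
      finally show ?thesis .
    qed
  qed
qed

subsection \<open>Constant extension\<close>

text \<open>
  With the constant extension beyond \<open>[a,b]\<close>, the conventions for \<open>left_lim\<close> at \<open>a\<close> and \<open>right_lim\<close>
  at \<open>b\<close> become ordinary one-sided limits.
\<close>

definition extend :: "real \<Rightarrow> real \<Rightarrow> (real \<Rightarrow> real) \<Rightarrow> real \<Rightarrow> real" where
  "extend a b f t = f (max a (min b t))"

lemma extend_eq [simp]: "t \<in> {a..b} \<Longrightarrow> extend a b f t = f t"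
  by (auto simp: extend_def max_def min_def)

lemma mono_extend: "mono_on {a..b} f \<Longrightarrow> a \<le> b \<Longrightarrow> mono (extend a b f)"
  unfolding mono_def extend_def by (auto intro!: mono_onD[of "{a..b}" f])

lemma left_lim_tendsto:
  assumes "sided_limits (extend a b f)" "a < b" "t \<in> {a..b}"
  shows "(extend a b f \<longlongrightarrow> left_lim a f t) (at_left t)"
proof (cases "t = a")
  case True
  have "\<forall>\<^sub>F s in at_left t. extend a b f s = f a"
    using True assms by (intro eventually_at_leftI[of "t - 1"]) (auto simp: extend_def max_def)
  with True show ?thesis by (simp add: left_lim_def tendsto_eventually)
next
  case False
  obtain l where l: "(extend a b f \<longlongrightarrow> l) (at_left t)"
    using assms(1) sided_limits_def by blast
  have "\<forall>\<^sub>F s in at_left t. extend a b f s = f s"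
    using False assms by (intro eventually_at_leftI[of a]) auto
  with l have "(f \<longlongrightarrow> l) (at_left t)" using tendsto_cong by blast
  then have "Lim (at_left t) f = l" by (intro tendsto_Lim) auto
  with l False show ?thesis by (simp add: left_lim_def)
qed

lemma right_lim_tendsto:
  assumes "sided_limits (extend a b f)" "a < b" "t \<in> {a..b}"
  shows "(extend a b f \<longlongrightarrow> right_lim b f t) (at_right t)"
proof (cases "t = b")
  case True
  have "\<forall>\<^sub>F s in at_right t. extend a b f s = f b"
    using True assms by (intro eventually_at_rightI[of _ "t + 1"]) (auto simp: extend_def max_def min_def)
  with True show ?thesis by (simp add: right_lim_def tendsto_eventually)
next
  case False
  obtain l where l: "(extend a b f \<longlongrightarrow> l) (at_right t)"
    using assms(1) sided_limits_def by blast
  have "\<forall>\<^sub>F s in at_right t. extend a b f s = f s"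
    using False assms by (intro eventually_at_rightI[of _ b]) auto
  with l have "(f \<longlongrightarrow> l) (at_right t)" using tendsto_cong by blast
  then have "Lim (at_right t) f = l" by (intro tendsto_Lim) auto
  with l False show ?thesis by (simp add: right_lim_def)
qed

lemma extend_diff:
  assumes "\<And>t. t \<in> {a..b} \<Longrightarrow> f t = g t - h t" "a \<le> b"
  shows "extend a b f = (\<lambda>t. extend a b g t - extend a b h t)"
  using assms by (auto simp: extend_def max_def min_def)

text \<open>\<open>Lim\<close> is a definite description and not additive as such; the identity
  passes through actual convergence and uniqueness of limits.\<close>

lemma
  assumes "\<And>t. t \<in> {a..b} \<Longrightarrow> f t = g t - h t" "a < b" "t \<in> {a..b}"
    and g: "sided_limits (extend a b g)" and h: "sided_limits (extend a b h)"
  shows left_lim_diff: "left_lim a f t = left_lim a g t - left_lim a h t"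
    and right_lim_diff: "right_lim b f t = right_lim b g t - right_lim b h t"
proof -
  have eq: "extend a b f = (\<lambda>t. extend a b g t - extend a b h t)"
    using assms by (intro extend_diff) auto
  then have f: "sided_limits (extend a b f)" using sided_limits_diff[OF g h] by simp
  have "(extend a b f \<longlongrightarrow> left_lim a g t - left_lim a h t) (at_left t)"
    unfolding eq using assms by (intro tendsto_diff left_lim_tendsto) auto
  then show "left_lim a f t = left_lim a g t - left_lim a h t"
    using tendsto_unique[OF _ left_lim_tendsto[OF f assms(2,3)]] by auto
  have "(extend a b f \<longlongrightarrow> right_lim b g t - right_lim b h t) (at_right t)"
    unfolding eq using assms by (intro tendsto_diff right_lim_tendsto) auto
  then show "right_lim b f t = right_lim b g t - right_lim b h t"
    using tendsto_unique[OF _ right_lim_tendsto[OF f assms(2,3)]] by auto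
qed

lemma lims_at_continuity:
  assumes f: "sided_limits (extend a b f)" and "a < b" "t \<in> {a..b}"
    and c: "continuous (at t within {a..b}) f"
  shows "left_lim a f t = f t" "right_lim b f t = f t"
proof -
  have lim: "(extend a b f \<longlongrightarrow> f t) (at t within {a..b})"
    using c unfolding continuous_within
    by (rule tendsto_cong[THEN iffD2, rotated]) (auto simp: eventually_at_filter)
  show "left_lim a f t = f t"
  proof (cases "t = a")
    case False
    then have "at t within {a..<t} = at_left t"
      using assms by (intro at_within_nhd[of _ "{a<..}"]) auto
    moreover have "(extend a b f \<longlongrightarrow> f t) (at t within {a..<t})"
      using assms by (intro tendsto_within_subset[OF lim]) auto
    ultimately show ?thesis
      using tendsto_unique[OF _ left_lim_tendsto[OF assms(1-3)]] by auto
  qed (simp add: left_lim_def)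
  show "right_lim b f t = f t"
  proof (cases "t = b")
    case False
    then have "at t within {t<..b} = at_right t"
      using assms by (intro at_within_nhd[of _ "{..<b}"]) auto
    moreover have "(extend a b f \<longlongrightarrow> f t) (at t within {t<..b})"
      using assms by (intro tendsto_within_subset[OF lim]) auto
    ultimately show ?thesis
      using tendsto_unique[OF _ right_lim_tendsto[OF assms(1-3)]] by auto
  qed (simp add: right_lim_def)
qed

text \<open>Each of the two products has one factor from \<alpha> and one from \<beta>, either a
  jump or a deviation from the mean of the one-sided limits. Continuity of one function makes both
  of its factors vanish, hence both products.\<close>

lemma parts_correction_eq_0:
  assumes "sided_limits (extend a b \<alpha>)" "sided_limits (extend a b \<beta>)" "a < b" "t \<in> {a..b}"
    and "t \<notin> common_discontinuities a b \<alpha> \<beta>"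
  shows "parts_correction a b \<alpha> \<beta> t = 0"
  using assms lims_at_continuity[of a b \<alpha> t] lims_at_continuity[of a b \<beta> t]
  by (auto simp: common_discontinuities_def parts_correction_def mu_point_def)

subsection \<open>Partitions and midpoint step functions\<close>

lemma partition_less:
  assumes "is_partition a b n x" "i < j" "j \<le> n"
  shows "x i < x j"
  using assms(2,3)
proof (induction j)
  case (Suc j)
  then have "x j < x (Suc j)" using assms(1) by (simp add: is_partition_def)
  with Suc show ?case by (cases "i = j") auto
qed simp

lemma partition_le: "is_partition a b n x \<Longrightarrow> i \<le> j \<Longrightarrow> j \<le> n \<Longrightarrow> x i \<le> x j"
  using partition_less[of a b n x i j] by (cases "i = j") auto

lemma partition_mem: "is_partition a b n x \<Longrightarrow> i \<le> n \<Longrightarrow> x i \<in> {a..b}"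
  using partition_le[of a b n x 0 i] partition_le[of a b n x i n] by (auto simp: is_partition_def)

lemma partition_inj_on: "is_partition a b n x \<Longrightarrow> inj_on x {0..n}"
  using partition_less[of a b n x] by (intro inj_onI) (metis atLeastAtMost_iff nat_neq_iff order_less_irrefl)

lemma partition_gap:
  assumes "is_partition a b n x" "i \<in> {1..n}" "t \<in> {x (i - 1)<..<x i}" "j \<le> n"
  shows "t \<noteq> x j"
proof (cases "j < i")
  case True
  then have "x j \<le> x (i - 1)" using assms by (intro partition_le) auto
  with assms(3) show ?thesis by auto
next
  case False
  then have "x i \<le> x j" using assms by (intro partition_le) auto
  with assms(3) show ?thesis by auto
qed

lemma partition_cases:
  assumes x: "is_partition a b n x" and t: "t \<in> {a..b}"
  obtains i where "i \<le> n" "t = x i" | i where "i \<in> {1..n}" "t \<in> {x (i - 1)<..<x i}"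
proof -
  define i where "i = (LEAST i. t \<le> x i)"
  have "t \<le> x n" using x t by (simp add: is_partition_def)
  then have i: "t \<le> x i" "i \<le> n"
    unfolding i_def by (rule LeastI, rule Least_le)
  show thesis
  proof (cases "t = x i")
    case False
    have "i \<noteq> 0"
    proof
      assume "i = 0"
      with i have "t \<le> x 0" by simp
      with False \<open>i = 0\<close> t x show False by (simp add: is_partition_def)
    qed
    then have "x (i - 1) < t" using not_less_Least[of "i - 1" "\<lambda>i. t \<le> x i"] by (auto simp: i_def)
    with False i \<open>i \<noteq> 0\<close> show thesis by (intro that(2)[of i]) auto
  qed (use i that(1) in auto)
qed

lemma partition_of_finite_set:
  assumes F: "finite F" "F \<subseteq> {a..b}" "a \<in> F" "b \<in> F"
  obtains n x where "is_partition a b n x" "x ` {0..n} = F"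
proof -
  define xs where "xs = sorted_list_of_set F"
  have xs: "set xs = F" "sorted_wrt (<) xs" "length xs \<noteq> 0"
    using F by (auto simp: xs_def strict_sorted_list_of_set)
  define n where "n = length xs - 1"
  have nth_less: "xs ! i < xs ! j" if "i < j" "j \<le> n" for i j
    using that xs(3) by (intro sorted_wrt_nth_less[OF xs(2)]) (auto simp: n_def)
  have "{0..n} = {i. i < length xs}" using xs(3) by (cases xs) (auto simp: n_def)
  then have img: "(!) xs ` {0..n} = F" using xs(1) by (auto simp: set_conv_nth)
  have "xs ! 0 = a"
  proof -
    obtain i where i: "i \<le> n" "xs ! i = a" using img F(3) by (metis atLeastAtMost_iff imageE)
    have "xs ! 0 \<in> {a..b}" using img F(2) by (metis atLeastAtMost_iff image_eqI le0 subsetD)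
    with i nth_less[of 0 i] show ?thesis by (cases "i = 0") auto
  qed
  moreover have "xs ! n = b"
  proof -
    obtain i where i: "i \<le> n" "xs ! i = b" using img F(4) by (metis atLeastAtMost_iff imageE)
    have "xs ! n \<in> {a..b}" using img F(2) by (metis atLeastAtMost_iff image_eqI le0 order_refl subsetD)
    with i nth_less[of i n] show ?thesis by (cases "i = n") auto
  qed
  ultimately have "is_partition a b n ((!) xs)"
    using nth_less by (auto simp: is_partition_def)
  with img that show thesis by blast
qed

text \<open>Bisection replaces a compactness argument. Locally, the two one-sided limits at a point
  control the values on either side of it, so removing that single point suffices. For gluing, the
  common endpoint joins the exceptional set, so that no admissible interval straddles it.\<close>

lemma small_oscillation_off_finite_set:
  assumes "a \<le> b" "sided_limits e" "0 < \<epsilon>"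
  shows "\<exists>P. finite P \<and> (\<forall>s t. a \<le> s \<longrightarrow> s \<le> t \<longrightarrow> t \<le> b \<longrightarrow> {s..t} \<inter> P = {} \<longrightarrow> \<bar>e s - e t\<bar> \<le> \<epsilon>)"
  using assms(1)
proof (induction a b rule: Bolzano)
  case (trans a b c)
  then obtain P Q where P: "finite P" "\<And>s t. a \<le> s \<Longrightarrow> s \<le> t \<Longrightarrow> t \<le> b \<Longrightarrow> {s..t} \<inter> P = {} \<Longrightarrow> \<bar>e s - e t\<bar> \<le> \<epsilon>"
    and Q: "finite Q" "\<And>s t. b \<le> s \<Longrightarrow> s \<le> t \<Longrightarrow> t \<le> c \<Longrightarrow> {s..t} \<inter> Q = {} \<Longrightarrow> \<bar>e s - e t\<bar> \<le> \<epsilon>"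
    by meson
  show ?case
  proof (intro exI[of _ "insert b (P \<union> Q)"] conjI allI impI)
    fix s t assume st: "a \<le> s" "s \<le> t" "t \<le> c" "{s..t} \<inter> insert b (P \<union> Q) = {}"
    then consider "t < b" | "b < s" by fastforce
    then show "\<bar>e s - e t\<bar> \<le> \<epsilon>"
      using st by cases (intro P(2) Q(2); auto)+
  qed (use P Q in auto)
next
  case (local x)
  obtain l r where l: "(e \<longlongrightarrow> l) (at_left x)" and r: "(e \<longlongrightarrow> r) (at_right x)"
    using assms(2) unfolding sided_limits_def by blast
  have "\<forall>\<^sub>F s in at_left x. dist (e s) l < \<epsilon> / 2" "\<forall>\<^sub>F s in at_right x. dist (e s) r < \<epsilon> / 2"
    using tendstoD[OF l, of "\<epsilon>/2"] tendstoD[OF r, of "\<epsilon>/2"] assms(3) by auto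
  then obtain p q where p: "p < x" "\<And>s. p < s \<Longrightarrow> s < x \<Longrightarrow> dist (e s) l < \<epsilon> / 2"
    and q: "x < q" "\<And>s. x < s \<Longrightarrow> s < q \<Longrightarrow> dist (e s) r < \<epsilon> / 2"
    unfolding eventually_at_left_field eventually_at_right_field by blast
  show ?case
  proof (intro exI[of _ "min (x - p) (q - x)"] conjI allI impI)
    fix c d assume cd: "c \<le> x \<and> x \<le> d \<and> d - c < min (x - p) (q - x)"
    show "\<exists>P. finite P \<and> (\<forall>s t. c \<le> s \<longrightarrow> s \<le> t \<longrightarrow> t \<le> d \<longrightarrow> {s..t} \<inter> P = {} \<longrightarrow> \<bar>e s - e t\<bar> \<le> \<epsilon>)"
    proof (intro exI[of _ "{x}"] conjI allI impI)
      fix s t assume st: "c \<le> s" "s \<le> t" "t \<le> d" "{s..t} \<inter> {x} = {}"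
      then consider "t < x" | "x < s" by fastforce
      then show "\<bar>e s - e t\<bar> \<le> \<epsilon>"
      proof cases
        case 1
        then have "dist (e s) l < \<epsilon> / 2" "dist (e t) l < \<epsilon> / 2" using st cd by (intro p(2); linarith)+
        then show ?thesis unfolding dist_real_def by linarith
      next
        case 2
        then have "dist (e s) r < \<epsilon> / 2" "dist (e t) r < \<epsilon> / 2" using st cd by (intro q(2); linarith)+
        then show ?thesis unfolding dist_real_def by linarith
      qed
    qed simp
  qed (use p q in auto)
qed

lemma abs_diff_limit_le:
  fixes f :: "real \<Rightarrow> real"
  assumes "(f \<longlongrightarrow> l) F" "F \<noteq> bot" "\<forall>\<^sub>F s in F. \<bar>y - f s\<bar> \<le> \<epsilon>"
  shows "\<bar>y - l\<bar> \<le> \<epsilon>"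
  by (rule tendsto_upperbound[OF _ assms(3,2)]) (intro tendsto_intros assms(1))

definition mid :: "real \<Rightarrow> real \<Rightarrow> (nat \<Rightarrow> real) \<Rightarrow> (real \<Rightarrow> real) \<Rightarrow> nat \<Rightarrow> real" where
  "mid a b x f i = (right_lim b f (x (i - 1)) + left_lim a f (x i)) / 2"

text \<open>Inside a gap of the partition, the \<open>LEAST\<close> is the index of the right
  endpoint, in agreement with the indexing in \<open>step_repr\<close>.\<close>

definition midpoint_step :: "real \<Rightarrow> real \<Rightarrow> nat \<Rightarrow> (nat \<Rightarrow> real) \<Rightarrow> (real \<Rightarrow> real) \<Rightarrow> real \<Rightarrow> real" where
  "midpoint_step a b n x f t = (if t \<in> x ` {0..n} then f t else mid a b x f (LEAST i. t \<le> x i))"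

lemma midpoint_step_point: "i \<le> n \<Longrightarrow> midpoint_step a b n x f (x i) = f (x i)"
  by (auto simp: midpoint_step_def)

lemma midpoint_step_repr:
  assumes x: "is_partition a b n x"
  shows "step_repr a b n x (mid a b x f) (midpoint_step a b n x f)"
  unfolding step_repr_def
proof (intro conjI ballI x)
  fix i t assume i: "i \<in> {1..n}" and t: "t \<in> {x (i - 1)<..<x i}"
  have "(LEAST j. t \<le> x j) = i"
  proof (rule Least_equality)
    fix j assume j: "t \<le> x j"
    show "i \<le> j"
    proof (rule ccontr)
      assume "\<not> i \<le> j"
      then have "x j \<le> x (i - 1)" using i by (intro partition_le[OF x]) auto
      with j t show False by auto
    qed
  qed (use t in auto)
  then show "midpoint_step a b n x f t = mid a b x f i"
    using partition_gap[OF x i t] unfolding midpoint_step_def by (metis atLeastAtMost_iff imageE)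
qed

text \<open>Inside a gap, \<open>f t\<close> is within \<epsilon> of all other values on that gap,
  hence of the one-sided limits at both ends, hence of their mean. At a partition point the error is
  zero.\<close>

lemma midpoint_step_close:
  assumes x: "is_partition a b n x" and f: "sided_limits (extend a b f)" and "a < b" "0 \<le> \<epsilon>"
    and osc: "\<And>s t. a \<le> s \<Longrightarrow> s \<le> t \<Longrightarrow> t \<le> b \<Longrightarrow> {s..t} \<inter> x ` {0..n} = {} \<Longrightarrow> \<bar>f s - f t\<bar> \<le> \<epsilon>"
    and t: "t \<in> {a..b}"
  shows "\<bar>f t - midpoint_step a b n x f t\<bar> \<le> \<epsilon>"
  using x t
proof (cases rule: partition_cases)
  case (1 i)
  then show ?thesis using \<open>0 \<le> \<epsilon>\<close> by (simp add: midpoint_step_point)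
next
  case (2 i)
  have lr: "x (i - 1) \<in> {a..b}" "x i \<in> {a..b}"
    using 2(1) partition_mem[OF x, of "i - 1"] partition_mem[OF x, of i] by auto
  have near: "\<bar>f t - extend a b f s\<bar> \<le> \<epsilon>" if s: "s \<in> {x (i - 1)<..<x i}" for s
  proof -
    \<comment> \<open>The oscillation bound expects ordered arguments, while \<open>s\<close> may
      lie on either side of \<open>t\<close>.\<close>
    have "{min s t..max s t} \<inter> x ` {0..n} = {}"
    proof -
      have "x j \<notin> {min s t..max s t}" if "j \<le> n" for j
      proof
        assume "x j \<in> {min s t..max s t}"
        then have "x j \<in> {x (i - 1)<..<x i}" using s 2(2) by (auto simp: min_def max_def split: if_splits)
        from partition_gap[OF x 2(1) this that] show False by simp
      qed
      then show ?thesis by auto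
    qed
    then have "\<bar>f (min s t) - f (max s t)\<bar> \<le> \<epsilon>"
      using s 2 lr by (intro osc) auto
    moreover have "extend a b f s = f s" using s lr by (intro extend_eq) auto
    ultimately show ?thesis by (auto simp: min_def max_def abs_minus_commute split: if_splits)
  qed
  have less: "x (i - 1) < x i" using 2 by auto
  have "\<bar>f t - right_lim b f (x (i - 1))\<bar> \<le> \<epsilon>"
    by (rule abs_diff_limit_le[OF right_lim_tendsto[OF f \<open>a < b\<close> lr(1)]])
       (simp, rule eventually_at_rightI[OF near less])
  moreover have "\<bar>f t - left_lim a f (x i)\<bar> \<le> \<epsilon>"
    by (rule abs_diff_limit_le[OF left_lim_tendsto[OF f \<open>a < b\<close> lr(2)]])
       (simp, rule eventually_at_leftI[OF near less])
  moreover have "midpoint_step a b n x f t = mid a b x f i"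
    using midpoint_step_repr[OF x, of f] 2 by (auto simp: step_repr_def)
  ultimately show ?thesis unfolding mid_def abs_le_iff by (auto simp: field_simps)
qed

subsection \<open>Functions of bounded variation\<close>

text \<open>Appending a last point is all that the variation function requires: with
  \<open>b\<close> it bounds the variation on every [a,t], and with a later point it shows how the
  variation grows.\<close>

lemma bounded_variation_extend_partition:
  assumes x: "is_partition a s n x" and "s < t"
  obtains x' where "is_partition a t (Suc n) x'"
    and "(\<Sum>i<Suc n. \<bar>f (x' (Suc i)) - f (x' i)\<bar>) = (\<Sum>i<n. \<bar>f (x (Suc i)) - f (x i)\<bar>) + \<bar>f t - f s\<bar>"
proof
  show "is_partition a t (Suc n) (x(Suc n := t))"
    using assms by (auto simp: is_partition_def less_Suc_eq)
  show "(\<Sum>i<Suc n. \<bar>f ((x(Suc n := t)) (Suc i)) - f ((x(Suc n := t)) i)\<bar>) =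
      (\<Sum>i<n. \<bar>f (x (Suc i)) - f (x i)\<bar>) + \<bar>f t - f s\<bar>"
    using x by (auto simp: is_partition_def intro!: sum.cong)
qed

text \<open>\<open>V t\<close> is the total variation on [a,t]. The single inequality
  \<open>V s + \<bar>f t - f s\<bar> \<le> V t\<close> makes both \<open>V\<close> and
  \<open>V - f\<close> increasing.\<close>

lemma jordan_decomposition:
  fixes f :: "real \<Rightarrow> real"
  assumes "bounded_variation_on a b f" "a \<le> b"
  obtains g h where "mono_on {a..b} g" "mono_on {a..b} h" "\<And>t. t \<in> {a..b} \<Longrightarrow> f t = g t - h t"
proof -
  define S where "S t = {\<Sum>i<n. \<bar>f (x (Suc i)) - f (x i)\<bar> |n x. is_partition a t n x}" for t
  define V where "V t = Sup (S t)" for t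
  obtain M where M: "\<And>n x. is_partition a b n x \<Longrightarrow> (\<Sum>i<n. \<bar>f (x (Suc i)) - f (x i)\<bar>) \<le> M"
    using assms(1) unfolding bounded_variation_on_def by blast
  have S_le: "y \<le> M" if "y \<in> S t" "t \<in> {a..b}" for y t
  proof (cases "t = b")
    case True
    with that M show ?thesis by (auto simp: S_def)
  next
    case False
    from that(1) obtain n x where x: "is_partition a t n x" "y = (\<Sum>i<n. \<bar>f (x (Suc i)) - f (x i)\<bar>)"
      by (auto simp: S_def)
    from False that(2) have "t < b" by auto
    from bounded_variation_extend_partition[OF x(1) this, of f] M x(2) show ?thesis
      by (smt (verit))
  qed
  have bdd: "bdd_above (S t)" if "t \<in> {a..b}" for t using S_le that by (meson bdd_aboveI)
  have ne: "S t \<noteq> {}" if "t \<in> {a..b}" for t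
  proof (cases "t = a")
    case True
    \<comment> \<open>The degenerate interval [a,a] has the partition without gaps, of variation
      0.\<close>
    then have "is_partition a t 0 (\<lambda>_. a)" by (simp add: is_partition_def)
    then show ?thesis unfolding S_def by blast
  next
    case False
    then have "is_partition a t 1 (\<lambda>i. if i = 0 then a else t)" using that by (simp add: is_partition_def)
    then show ?thesis unfolding S_def by blast
  qed
  have step: "V s + \<bar>f t - f s\<bar> \<le> V t" if st: "s \<in> {a..b}" "t \<in> {a..b}" "s \<le> t" for s t
  proof (cases "s = t")
    case False
    have "V s \<le> V t - \<bar>f t - f s\<bar>"
      unfolding V_def[of s]
    proof (rule cSup_least[OF ne[OF st(1)]])
      fix y assume "y \<in> S s"
      then obtain n x where x: "is_partition a s n x" "y = (\<Sum>i<n. \<bar>f (x (Suc i)) - f (x i)\<bar>)"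
        by (auto simp: S_def)
      have "s < t" using False st by simp
      from bounded_variation_extend_partition[OF x(1) this, of f] obtain x' where
        "is_partition a t (Suc n) x'" "(\<Sum>i<Suc n. \<bar>f (x' (Suc i)) - f (x' i)\<bar>) = y + \<bar>f t - f s\<bar>"
        using x(2) by metis
      then have "y + \<bar>f t - f s\<bar> \<in> S t" unfolding S_def by (metis (mono_tags, lifting) mem_Collect_eq)
      then have "y + \<bar>f t - f s\<bar> \<le> V t" unfolding V_def using bdd[OF st(2)] by (rule cSup_upper)
      then show "y \<le> V t - \<bar>f t - f s\<bar>" by simp
    qed
    then show ?thesis by simp
  qed simp
  show thesis
  proof (rule that[of V "\<lambda>t. V t - f t"])
    show "mono_on {a..b} V" using step by (intro mono_onI) (smt (verit))
    show "mono_on {a..b} (\<lambda>t. V t - f t)" using step by (intro mono_onI) (smt (verit))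
  qed simp
qed

lemma bounded_variation_sided_limits:
  assumes "bounded_variation_on a b f" "a \<le> b"
  shows "sided_limits (extend a b f)"
proof -
  obtain g h where gh: "mono_on {a..b} g" "mono_on {a..b} h" "\<And>t. t \<in> {a..b} \<Longrightarrow> f t = g t - h t"
    using jordan_decomposition[OF assms] by blast
  then have "sided_limits (\<lambda>t. extend a b g t - extend a b h t)"
    using assms(2) by (intro sided_limits_diff mono_sided_limits mono_extend)
  with gh(3) assms(2) show ?thesis by (subst extend_diff)
qed

lemma bounded_image_mono_on:
  fixes g :: "real \<Rightarrow> real"
  assumes "mono_on {a..b} g"
  shows "bounded (g ` {a..b})"
proof (rule boundedI)
  fix y assume "y \<in> g ` {a..b}"
  then obtain t where "t \<in> {a..b}" "y = g t" by auto
  with assms show "norm y \<le> \<bar>g a\<bar> + \<bar>g b\<bar>"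
    using mono_onD[OF assms, of a t] mono_onD[OF assms, of t b] by auto
qed

lemma bounded_variation_bounded:
  assumes "bounded_variation_on a b f" "a \<le> b"
  shows "bounded (f ` {a..b})"
proof -
  obtain g h where gh: "mono_on {a..b} g" "mono_on {a..b} h" "\<And>t. t \<in> {a..b} \<Longrightarrow> f t = g t - h t"
    using jordan_decomposition[OF assms] by blast
  have "f ` {a..b} = (\<lambda>t. g t - h t) ` {a..b}" using gh(3) by auto
  with gh(1,2) show ?thesis by (simp add: bounded_minus_comp bounded_image_mono_on)
qed

subsection \<open>Step integrals\<close>

definition step_sum ::
  "real \<Rightarrow> real \<Rightarrow> (real \<Rightarrow> real) \<Rightarrow> nat \<Rightarrow> (nat \<Rightarrow> real) \<Rightarrow> (nat \<Rightarrow> real) \<Rightarrow> (real \<Rightarrow> real) \<Rightarrow> real" where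
  "step_sum a b \<alpha> n x c u = (\<Sum>i=0..n. u (x i) * mu_point a b \<alpha> (x i)) +
            (\<Sum>i=1..n. c i * mu_open a b \<alpha> (x (i - 1)) (x i))"

text \<open>The pointwise counterpart of \<open>step_sum\<close>: integrating the right-hand side
  term by term turns the indicators into the masses of points and gaps. The induction appends one
  gap together with its right endpoint.\<close>

lemma step_repr_indicator_sum:
  assumes u: "step_repr a b n x c u"
  shows "indicator {a..b} t * u t =
    (\<Sum>i=0..n. u (x i) * indicator {x i} t) + (\<Sum>i=1..n. c i * indicator {x (i - 1)<..<x i} t)"
proof -
  have x: "is_partition a b n x" using u by (simp add: step_repr_def)
  have "indicator {a..x k} t * u t =
      (\<Sum>i=0..k. u (x i) * indicator {x i} t) + (\<Sum>i=1..k. c i * indicator {x (i - 1)<..<x i} t)"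
    if "k \<le> n" for k
    using that
  proof (induction k)
    case 0
    then show ?case using x by (auto simp: is_partition_def indicator_def)
  next
    case (Suc k)
    have "a \<le> x k" "x k < x (Suc k)"
      using partition_mem[OF x, of k] partition_less[OF x, of k "Suc k"] Suc.prems by auto
    moreover have "u t = c (Suc k)" if "x k < t" "t < x (Suc k)"
      using u that Suc.prems by (auto simp: step_repr_def)
    ultimately have "indicator {a..x (Suc k)} t * u t = indicator {a..x k} t * u t +
        (u (x (Suc k)) * indicator {x (Suc k)} t + c (Suc k) * indicator {x k<..<x (Suc k)} t)"
      by (auto simp: indicator_def)
    with Suc show ?case by simp
  qed
  from this[of n] x show ?thesis by (simp add: is_partition_def)
qed

lemma step_functionI:
  assumes "step_repr a b n x c u"
  shows "step_function a b u"
proof -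
  have x: "is_partition a b n x" using assms by (simp add: step_repr_def)
  have "u ` {a..b} \<subseteq> u ` x ` {0..n} \<union> c ` {1..n}"
  proof
    fix y assume "y \<in> u ` {a..b}"
    then obtain t where t: "t \<in> {a..b}" "y = u t" by auto
    from x t(1) show "y \<in> u ` x ` {0..n} \<union> c ` {1..n}"
      by (cases rule: partition_cases) (use assms t(2) in \<open>auto simp: step_repr_def\<close>)
  qed
  then have "finite (u ` {a..b})" by (rule finite_subset) auto
  then show ?thesis unfolding step_function_def using assms finite_imp_bounded by blast
qed

lemma step_repr_add:
  "step_repr a b n x c u \<Longrightarrow> step_repr a b n x (\<lambda>i. c i + e) (\<lambda>t. u t + e)"
  by (auto simp: step_repr_def)

lemma mono_le_right_limit:
  fixes e :: "real \<Rightarrow> real"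
  assumes "mono e" "(e \<longlongrightarrow> p) (at_right c)"
  shows "e c \<le> p"
  using assms monoD[OF assms(1)]
  by (intro tendsto_lowerbound[OF assms(2)] eventually_at_rightI[of c "c+1"]) auto

lemma mono_ge_left_limit:
  fixes e :: "real \<Rightarrow> real"
  assumes "mono e" "(e \<longlongrightarrow> p) (at_left c)"
  shows "p \<le> e c"
  using assms monoD[OF assms(1)]
  by (intro tendsto_upperbound[OF assms(2)] eventually_at_leftI[of "c-1"]) auto

lemma mono_right_limit_le_left_limit:
  fixes e :: "real \<Rightarrow> real"
  assumes e: "mono e" and "c < d" and p: "(e \<longlongrightarrow> p) (at_right c)" and q: "(e \<longlongrightarrow> q) (at_left d)"
  shows "p \<le> q"
proof -
  let ?m = "(c + d) / 2"
  have "p \<le> e ?m"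
    using assms monoD[OF e]
    by (intro tendsto_upperbound[OF p] eventually_at_rightI[of c ?m]) auto
  also have "e ?m \<le> q"
    using assms monoD[OF e]
    by (intro tendsto_lowerbound[OF q] eventually_at_leftI[of ?m]) auto
  finally show ?thesis .
qed

text \<open>
  A linear functional on functions, here the Lebesgue integral, settles at once that the step sum
  does not depend on the partition and that it is monotone in the step function.
\<close>

lemma step_sum_positive_functional:
  assumes \<alpha>: "mono_on {a..b} \<alpha>" and "a < b"
  obtains J :: "(real \<Rightarrow> real) \<Rightarrow> real" where
    "\<forall>n x c u. step_repr a b n x c u \<longrightarrow> J u = step_sum a b \<alpha> n x c u"
    "\<forall>u v. step_function a b u \<longrightarrow> step_function a b v \<longrightarrow> (\<forall>t\<in>{a..b}. u t \<le> v t) \<longrightarrow> J u \<le> J v"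
    "\<forall>u e. step_function a b u \<longrightarrow> J (\<lambda>t. u t + e) = J u + e * (\<alpha> b - \<alpha> a)"
proof -
  let ?e = "extend a b \<alpha>"
  have e: "mono ?e" using \<alpha> \<open>a < b\<close> by (intro mono_extend) auto
  note sl = mono_sided_limits[OF e]
  note left = left_lim_tendsto[OF sl \<open>a < b\<close>] and right = right_lim_tendsto[OF sl \<open>a < b\<close>]
  obtain M where M: "sets M = sets borel"
    and Ioo: "\<And>c d p q. c < d \<Longrightarrow> (?e \<longlongrightarrow> p) (at_right c) \<Longrightarrow> (?e \<longlongrightarrow> q) (at_left d)
           \<Longrightarrow> emeasure M {c<..<d} = ennreal (q - p)"
    and pt: "\<And>c p q. (?e \<longlongrightarrow> p) (at_left c) \<Longrightarrow> (?e \<longlongrightarrow> q) (at_right c) \<Longrightarrow> emeasure M {c} = ennreal (q - p)"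
    using stieltjes_measure_exists[OF e] by blast
  \<comment> \<open>Nonnegativity is recorded as well, since only then does passing from
    \<open>ennreal\<close> back to the reals return the same number.\<close>
  have em_pt: "emeasure M {t} = ennreal (mu_point a b \<alpha> t)" and nn_pt: "0 \<le> mu_point a b \<alpha> t" if "t \<in> {a..b}" for t
    using pt[OF left[OF that] right[OF that]]
      mono_ge_left_limit[OF e left[OF that]] mono_le_right_limit[OF e right[OF that]]
    by (auto simp: mu_point_def)
  have em_Ioo: "emeasure M {s<..<t} = ennreal (mu_open a b \<alpha> s t)" and nn_Ioo: "0 \<le> mu_open a b \<alpha> s t"
    if "s \<in> {a..b}" "t \<in> {a..b}" "s < t" for s t
    using Ioo[OF that(3) right[OF that(1)] left[OF that(2)]]
      mono_right_limit_le_left_limit[OF e that(3) right[OF that(1)] left[OF that(2)]]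
    by (auto simp: mu_open_def)
  \<comment> \<open>The indicator cuts off the values of \<open>u\<close> outside [a,b], on which
    \<open>step_repr\<close> imposes nothing.\<close>
  define J where "J u = (\<integral>t. indicator {a..b} t * u t \<partial>M)" for u :: "real \<Rightarrow> real"
  have hbi: "has_bochner_integral M (\<lambda>t. indicator {a..b} t * u t) (step_sum a b \<alpha> n x c u)"
    if u: "step_repr a b n x c u" for n x c u
  proof -
    have x: "is_partition a b n x" using u by (simp add: step_repr_def)
    have 1: "has_bochner_integral M (indicator {x i}) (mu_point a b \<alpha> (x i))" if "i \<in> {0..n}" for i
    proof -
      have "x i \<in> {a..b}" using that by (intro partition_mem[OF x]) simp
      from em_pt[OF this] nn_pt[OF this] show ?thesis
        using has_bochner_integral_real_indicator[of "{x i}" M] M by (simp add: measure_def)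
    qed
    have 2: "has_bochner_integral M (indicator {x (i - 1)<..<x i}) (mu_open a b \<alpha> (x (i - 1)) (x i))"
      if "i \<in> {1..n}" for i
    proof -
      have "x (i - 1) \<in> {a..b}" "x i \<in> {a..b}" "x (i - 1) < x i"
        using that partition_mem[OF x, of "i - 1"] partition_mem[OF x, of i] partition_less[OF x, of "i - 1" i]
        by auto
      from em_Ioo[OF this] nn_Ioo[OF this] show ?thesis
        using has_bochner_integral_real_indicator[of "{x (i - 1)<..<x i}" M] M by (simp add: measure_def)
    qed
    show ?thesis
      unfolding step_repr_indicator_sum[OF u] step_sum_def
      by (intro has_bochner_integral_add has_bochner_integral_sum has_bochner_integral_mult_right 1 2)
  qed
  have J_eq: "J u = step_sum a b \<alpha> n x c u" if "step_repr a b n x c u" for n x c u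
    unfolding J_def by (rule has_bochner_integral_integral_eq[OF hbi[OF that]])
  have int: "integrable M (\<lambda>t. indicator {a..b} t * u t)" if "step_function a b u" for u
    using that hbi unfolding step_function_def by (meson integrable.intros)
  have one: "step_repr a b 1 (\<lambda>i. if i = 0 then a else b) (\<lambda>_. 1) (\<lambda>_. 1)"
    using \<open>a < b\<close> by (auto simp: step_repr_def is_partition_def)
  \<comment> \<open>By the conventions at \<open>a\<close> and \<open>b\<close>, the two endpoint
    jumps and the single gap add up to the full increase of \<alpha>.\<close>
  have J_one: "J (\<lambda>_. 1) = \<alpha> b - \<alpha> a"
    unfolding J_eq[OF one]
    by (simp add: step_sum_def mu_point_def mu_open_def left_lim_def right_lim_def)
  show thesis
  proof (rule that; intro allI impI)
    show "J u = step_sum a b \<alpha> n x c u" if "step_repr a b n x c u" for n x c u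
      using that by (rule J_eq)
    show "J u \<le> J v" if "step_function a b u" "step_function a b v" "\<forall>t\<in>{a..b}. u t \<le> v t" for u v
      unfolding J_def using that by (intro integral_mono int) (auto simp: indicator_def)
    show "J (\<lambda>t. u t + e) = J u + e * (\<alpha> b - \<alpha> a)" if "step_function a b u" for u e
    proof -
      have "J (\<lambda>t. u t + e) = (\<integral>t. indicator {a..b} t * u t + e * (indicator {a..b} t * 1) \<partial>M)"
        unfolding J_def by (simp add: algebra_simps)
      also have "\<dots> = J u + e * J (\<lambda>_. 1)"
        unfolding J_def using int[OF that] int[OF step_functionI[OF one]]
        by (subst Bochner_Integration.integral_add) auto
      finally show ?thesis by (simp add: J_one)
    qed
  qed
qed

lemma step_function_add: "step_function a b u \<Longrightarrow> step_function a b (\<lambda>t. u t + e)"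
  unfolding step_function_def[of a b u] by (blast intro: step_functionI step_repr_add)

context
  fixes a b :: real and \<alpha> :: "real \<Rightarrow> real"
  assumes mono: "mono_on {a..b} \<alpha>" and less: "a < b"
begin

text \<open>All representations of a step function give the value of the same functional
  \<open>J\<close>, so the description in \<open>step_integral\<close> is met by exactly one number,
  and monotonicity and translation carry over from \<open>J\<close>.\<close>

lemma
  shows step_integral_eq_step_sum:
      "step_repr a b n x c u \<Longrightarrow> step_integral a b \<alpha> u = step_sum a b \<alpha> n x c u"
    and step_integral_mono:
      "step_function a b u \<Longrightarrow> step_function a b v \<Longrightarrow> (\<And>t. t \<in> {a..b} \<Longrightarrow> u t \<le> v t)
        \<Longrightarrow> step_integral a b \<alpha> u \<le> step_integral a b \<alpha> v"
    and step_integral_add_const: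
      "step_function a b u
        \<Longrightarrow> step_integral a b \<alpha> (\<lambda>t. u t + e) = step_integral a b \<alpha> u + e * (\<alpha> b - \<alpha> a)"
proof -
  obtain J :: "(real \<Rightarrow> real) \<Rightarrow> real" where J:
    "\<forall>n x c u. step_repr a b n x c u \<longrightarrow> J u = step_sum a b \<alpha> n x c u"
    "\<forall>u v. step_function a b u \<longrightarrow> step_function a b v \<longrightarrow> (\<forall>t\<in>{a..b}. u t \<le> v t) \<longrightarrow> J u \<le> J v"
    "\<forall>u e. step_function a b u \<longrightarrow> J (\<lambda>t. u t + e) = J u + e * (\<alpha> b - \<alpha> a)"
    using step_sum_positive_functional[OF mono less] .
  have eq: "step_integral a b \<alpha> u = J u" if u: "step_function a b u" for u
  proof -
    have "\<exists>n x c. step_repr a b n x c u \<and> J u = step_sum a b \<alpha> n x c u"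
      using u J(1) unfolding step_function_def by blast
    moreover have "I = J u" if "\<exists>n x c. step_repr a b n x c u \<and> I = step_sum a b \<alpha> n x c u" for I
      using that J(1) by force
    ultimately show ?thesis
      unfolding step_integral_def step_sum_def[symmetric] by (rule the_equality)
  qed
  show "step_integral a b \<alpha> u = step_sum a b \<alpha> n x c u" if "step_repr a b n x c u"
    using that by (simp add: eq step_functionI J(1))
  show "step_integral a b \<alpha> u \<le> step_integral a b \<alpha> v"
    if "step_function a b u" "step_function a b v" "\<And>t. t \<in> {a..b} \<Longrightarrow> u t \<le> v t"
    using J(2) that by (simp add: eq)
  show "step_integral a b \<alpha> (\<lambda>t. u t + e) = step_integral a b \<alpha> u + e * (\<alpha> b - \<alpha> a)"
    if "step_function a b u"
    using J(3) that by (simp add: eq that step_function_add)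
qed

text \<open>The shifts of \<open>u\<close> by \<epsilon> down and up are admissible competitors
  below and above \<open>f\<close>, and each bounds all competitors from the other side. Their
  integrals differ from that of \<open>u\<close> by \<epsilon> times the total increase of
  \<alpha>.\<close>

lemma RDS_bounds:
  assumes u: "step_function a b u" and close: "\<forall>t\<in>{a..b}. \<bar>f t - u t\<bar> \<le> \<epsilon>"
  shows "\<bar>RDS_lower a b \<alpha> f - step_integral a b \<alpha> u\<bar> \<le> \<epsilon> * (\<alpha> b - \<alpha> a)"
    and "\<bar>RDS_upper a b \<alpha> f - step_integral a b \<alpha> u\<bar> \<le> \<epsilon> * (\<alpha> b - \<alpha> a)"
proof -
  let ?I = "step_integral a b \<alpha>"
  define A where "A = {?I v |v. step_function a b v \<and> (\<forall>t\<in>{a..b}. v t \<le> f t)}"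
  define B where "B = {?I v |v. step_function a b v \<and> (\<forall>t\<in>{a..b}. f t \<le> v t)}"
  have sf: "step_function a b (\<lambda>t. u t + e)" for e using u by (rule step_function_add)
  have lo: "u t + - \<epsilon> \<le> f t" and hi: "f t \<le> u t + \<epsilon>" if "t \<in> {a..b}" for t
    using bspec[OF close that] by auto
  have inA: "?I (\<lambda>t. u t + - \<epsilon>) \<in> A" unfolding A_def using sf lo by blast
  have inB: "?I (\<lambda>t. u t + \<epsilon>) \<in> B" unfolding B_def using sf hi by blast
  have A_le: "y \<le> ?I (\<lambda>t. u t + \<epsilon>)" if "y \<in> A" for y
    using that order_trans[OF _ hi] unfolding A_def by (auto intro!: step_integral_mono sf)
  have B_ge: "?I (\<lambda>t. u t + - \<epsilon>) \<le> y" if "y \<in> B" for y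
    using that order_trans[OF lo] unfolding B_def by (auto simp del: add_uminus_conv_diff intro!: step_integral_mono sf)
  have "Sup A \<le> ?I (\<lambda>t. u t + \<epsilon>)" "?I (\<lambda>t. u t + - \<epsilon>) \<le> Sup A"
    using inA A_le by (auto intro!: cSup_least cSup_upper bdd_aboveI)
  then show "\<bar>RDS_lower a b \<alpha> f - ?I u\<bar> \<le> \<epsilon> * (\<alpha> b - \<alpha> a)"
    unfolding step_integral_add_const[OF u] RDS_lower_def A_def[symmetric] by (auto simp: abs_le_iff)
  have "?I (\<lambda>t. u t + - \<epsilon>) \<le> Inf B" "Inf B \<le> ?I (\<lambda>t. u t + \<epsilon>)"
    using inB B_ge by (auto intro!: cInf_greatest cInf_lower bdd_belowI)
  then show "\<bar>RDS_upper a b \<alpha> f - ?I u\<bar> \<le> \<epsilon> * (\<alpha> b - \<alpha> a)"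
    unfolding step_integral_add_const[OF u] RDS_upper_def B_def[symmetric] by (auto simp: abs_le_iff)
qed

end

subsection \<open>Integrals of uniform limits of step functions\<close>

definition step_approximable :: "real \<Rightarrow> real \<Rightarrow> (real \<Rightarrow> real) \<Rightarrow> bool" where
  "step_approximable a b f \<longleftrightarrow>
     (\<forall>\<epsilon>>0. \<exists>u. step_function a b u \<and> (\<forall>t\<in>{a..b}. \<bar>f t - u t\<bar> \<le> \<epsilon>))"

lemma zero_if_arbitrarily_small:
  fixes d K :: real
  assumes "\<And>\<epsilon>. 0 < \<epsilon> \<Longrightarrow> \<bar>d\<bar> \<le> \<epsilon> * K"
  shows "d = 0"
proof -
  have "((\<lambda>\<epsilon>. \<epsilon> * K) \<longlongrightarrow> 0 * K) (at_right 0)" by (intro tendsto_intros)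
  then have "\<bar>d\<bar> \<le> 0 * K"
    by (rule tendsto_lowerbound) (use assms in \<open>auto intro!: eventually_at_rightI[of 0 1]\<close>)
  then show ?thesis by simp
qed

lemma step_approximable_RDS_integrable_inc:
  assumes \<alpha>: "mono_on {a..b} \<alpha>" "a < b" and f: "step_approximable a b f" "bounded (f ` {a..b})"
  shows "RDS_integrable_inc a b \<alpha> f"
proof -
  have "RDS_lower a b \<alpha> f - RDS_upper a b \<alpha> f = 0"
  proof (rule zero_if_arbitrarily_small)
    fix \<epsilon> :: real assume "0 < \<epsilon>"
    then obtain u where "step_function a b u" "\<forall>t\<in>{a..b}. \<bar>f t - u t\<bar> \<le> \<epsilon>"
      using f(1) unfolding step_approximable_def by blast
    from RDS_bounds[OF \<alpha> this]
    show "\<bar>RDS_lower a b \<alpha> f - RDS_upper a b \<alpha> f\<bar> \<le> \<epsilon> * (2 * (\<alpha> b - \<alpha> a))" by linarith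
  qed
  with \<alpha> f show ?thesis by (simp add: RDS_integrable_inc_def)
qed

text \<open>The identification of \<open>step_integral\<close> is available for increasing
  integrators only. \<open>step_sum\<close> is an explicit expression, linear in the integrator, so
  it is the quantity to compare with when \<alpha> has bounded variation.\<close>

lemma step_sum_diff:
  assumes eq: "\<forall>t\<in>{a..b}. \<alpha> t = g t - h t" and "mono_on {a..b} g" "mono_on {a..b} h" "a < b"
    and x: "is_partition a b n x"
  shows "step_sum a b \<alpha> n x c u = step_sum a b g n x c u - step_sum a b h n x c u"
proof -
  have sl: "sided_limits (extend a b g)" "sided_limits (extend a b h)"
    using assms by (auto intro!: mono_sided_limits mono_extend)
  have l: "left_lim a \<alpha> t = left_lim a g t - left_lim a h t"
    and r: "right_lim b \<alpha> t = right_lim b g t - right_lim b h t" if "t \<in> {a..b}" for t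
    using left_lim_diff[OF bspec[OF eq] \<open>a < b\<close> that sl] right_lim_diff[OF bspec[OF eq] \<open>a < b\<close> that sl] by auto
  have p: "mu_point a b \<alpha> (x i) = mu_point a b g (x i) - mu_point a b h (x i)" if "i \<in> {0..n}" for i
    using that l r partition_mem[OF x, of i] by (simp add: mu_point_def)
  have o: "mu_open a b \<alpha> (x (i - 1)) (x i) = mu_open a b g (x (i - 1)) (x i) - mu_open a b h (x (i - 1)) (x i)"
    if "i \<in> {1..n}" for i
    using that l r partition_mem[OF x, of i] partition_mem[OF x, of "i - 1"] by (auto simp: mu_open_def)
  show ?thesis
    unfolding step_sum_def by (simp add: p o right_diff_distrib sum_subtractf del: One_nat_def)
qed

text \<open>The step sum refers to \<alpha> alone and not to \<open>g\<close> and \<open>h\<close>,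
  which lets it mediate between different decompositions.\<close>

lemma RDS_decomp_close:
  assumes d: "RDS_decomp a b \<alpha> f g h" and "a < b"
    and u: "step_repr a b n x c u" and close: "\<forall>t\<in>{a..b}. \<bar>f t - u t\<bar> \<le> \<epsilon>"
  shows "\<bar>(RDS_integral_inc a b g f - RDS_integral_inc a b h f) - step_sum a b \<alpha> n x c u\<bar>
    \<le> \<epsilon> * ((g b - g a) + (h b - h a))"
proof -
  have mono: "mono_on {a..b} g" "mono_on {a..b} h" and eq: "\<forall>t\<in>{a..b}. \<alpha> t = g t - h t"
    using d by (auto simp: RDS_decomp_def RDS_integrable_inc_def)
  have x: "is_partition a b n x" using u by (simp add: step_repr_def)
  show ?thesis
    using RDS_bounds(1)[OF mono(1) \<open>a < b\<close> step_functionI[OF u] close]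
      RDS_bounds(1)[OF mono(2) \<open>a < b\<close> step_functionI[OF u] close]
    unfolding RDS_integral_inc_def step_sum_diff[OF eq mono \<open>a < b\<close> x]
      step_integral_eq_step_sum[OF mono(1) \<open>a < b\<close> u] step_integral_eq_step_sum[OF mono(2) \<open>a < b\<close> u]
      distrib_left[of _ "g b - g a"] by linarith
qed

text \<open>Two decompositions give values close to the same step sum, with an error proportional to
  \<epsilon>; as \<epsilon> is arbitrary, the values agree.\<close>

lemma RDS_integral_eq:
  assumes d: "RDS_decomp a b \<alpha> f g h" and "a < b" and f: "step_approximable a b f"
  shows "RDS_integral a b \<alpha> f = RDS_integral_inc a b g f - RDS_integral_inc a b h f"
  unfolding RDS_integral_def
proof (rule the_equality)
  fix I assume "\<exists>\<alpha>p \<alpha>m. RDS_decomp a b \<alpha> f \<alpha>p \<alpha>m \<and> I = RDS_integral_inc a b \<alpha>p f - RDS_integral_inc a b \<alpha>m f"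
  then obtain g' h' where d': "RDS_decomp a b \<alpha> f g' h'" and I: "I = RDS_integral_inc a b g' f - RDS_integral_inc a b h' f"
    by blast
  have "I - (RDS_integral_inc a b g f - RDS_integral_inc a b h f) = 0"
  proof (rule zero_if_arbitrarily_small)
    fix \<epsilon> :: real assume "0 < \<epsilon>"
    then obtain u where "step_function a b u" and close: "\<forall>t\<in>{a..b}. \<bar>f t - u t\<bar> \<le> \<epsilon>"
      using f unfolding step_approximable_def by blast
    then obtain n x c where u: "step_repr a b n x c u" unfolding step_function_def by blast
    show "\<bar>I - (RDS_integral_inc a b g f - RDS_integral_inc a b h f)\<bar> \<le>
        \<epsilon> * (((g b - g a) + (h b - h a)) + ((g' b - g' a) + (h' b - h' a)))"
      using RDS_decomp_close[OF d \<open>a < b\<close> u close] RDS_decomp_close[OF d' \<open>a < b\<close> u close]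
      unfolding I distrib_left[of _ "(g b - g a) + (h b - h a)"] by linarith
  qed
  then show "I = RDS_integral_inc a b g f - RDS_integral_inc a b h f" by simp
qed (use d in blast)

lemma bounded_variation_step_approximable:
  assumes f: "bounded_variation_on a b f" and "a < b"
  shows "step_approximable a b f"
  unfolding step_approximable_def
proof (intro allI impI)
  fix \<epsilon> :: real assume "0 < \<epsilon>"
  have sl: "sided_limits (extend a b f)" using assms by (intro bounded_variation_sided_limits) auto
  obtain P where P: "finite P" "\<And>s t. a \<le> s \<Longrightarrow> s \<le> t \<Longrightarrow> t \<le> b \<Longrightarrow> {s..t} \<inter> P = {}
      \<Longrightarrow> \<bar>extend a b f s - extend a b f t\<bar> \<le> \<epsilon>"
    using small_oscillation_off_finite_set[OF less_imp_le[OF \<open>a < b\<close>] sl \<open>0 < \<epsilon>\<close>] by blast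
  \<comment> \<open>The exceptional set may stick out of [a,b], so it is cut down; the endpoints are
    added because a partition must contain them.\<close>
  obtain n x where x: "is_partition a b n x" and img: "x ` {0..n} = {a, b} \<union> (P \<inter> {a..b})"
    using partition_of_finite_set[of "{a, b} \<union> (P \<inter> {a..b})" a b] P(1) \<open>a < b\<close> by auto
  have "\<bar>f t - midpoint_step a b n x f t\<bar> \<le> \<epsilon>" if "t \<in> {a..b}" for t
  proof (rule midpoint_step_close[OF x sl \<open>a < b\<close> _ _ that])
    show "\<bar>f s - f t\<bar> \<le> \<epsilon>" if "a \<le> s" "s \<le> t" "t \<le> b" "{s..t} \<inter> x ` {0..n} = {}" for s t
    proof -
      have "P \<inter> {a..b} \<subseteq> x ` {0..n}" "{s..t} \<subseteq> {a..b}" using that img by auto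
      then have "{s..t} \<inter> P = {}" using that(4) by blast
      with P(2)[of s t] that show ?thesis by simp
    qed
  qed (use \<open>0 < \<epsilon>\<close> in simp)
  then show "\<exists>u. step_function a b u \<and> (\<forall>t\<in>{a..b}. \<bar>f t - u t\<bar> \<le> \<epsilon>)"
    using step_functionI[OF midpoint_step_repr[OF x]] by blast
qed

lemma bounded_variation_RDS_decomp:
  assumes "bounded_variation_on a b \<alpha>" "bounded_variation_on a b f" "a < b"
  obtains g h where "RDS_decomp a b \<alpha> f g h"
proof -
  obtain g h where "mono_on {a..b} g" "mono_on {a..b} h" "\<And>t. t \<in> {a..b} \<Longrightarrow> \<alpha> t = g t - h t"
    using jordan_decomposition[OF assms(1)] assms(3) by auto
  moreover have "step_approximable a b f" "bounded (f ` {a..b})"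
    using assms by (auto intro: bounded_variation_step_approximable bounded_variation_bounded)
  ultimately have "RDS_decomp a b \<alpha> f g h"
    unfolding RDS_decomp_def using assms(3) by (auto intro: step_approximable_RDS_integrable_inc)
  then show thesis by (rule that)
qed

text \<open>Hides the decomposition: \<open>K\<close> is the total increase of its two parts, fixed
  before the step function, the partition and \<epsilon>. This uniformity is what permits arbitrary
  refinements later.\<close>

lemma RDS_integral_close:
  assumes "bounded_variation_on a b \<alpha>" "bounded_variation_on a b f" "a < b"
  obtains K where "0 \<le> K"
    and "\<And>n x c u \<epsilon>. step_repr a b n x c u \<Longrightarrow> \<forall>t\<in>{a..b}. \<bar>f t - u t\<bar> \<le> \<epsilon>
      \<Longrightarrow> \<bar>RDS_integral a b \<alpha> f - step_sum a b \<alpha> n x c u\<bar> \<le> \<epsilon> * K"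
proof -
  obtain g h where d: "RDS_decomp a b \<alpha> f g h" using bounded_variation_RDS_decomp[OF assms] .
  have eq: "RDS_integral a b \<alpha> f = RDS_integral_inc a b g f - RDS_integral_inc a b h f"
    using d assms(3) bounded_variation_step_approximable[OF assms(2,3)] by (rule RDS_integral_eq)
  have "mono_on {a..b} g" "mono_on {a..b} h"
    using d by (auto simp: RDS_decomp_def RDS_integrable_inc_def)
  then have "g a \<le> g b" "h a \<le> h b" using assms(3) by (auto intro: mono_onD)
  then show thesis
    using RDS_decomp_close[OF d assms(3)] by (intro that[of "(g b - g a) + (h b - h a)"]) (auto simp: eq)
qed

subsection \<open>Integration by parts\<close>

text \<open>
  Both a point and an open interval contribute a difference of products of one-sided limits, because
  \<open>(p + q) / 2 * (s - r) + (r + s) / 2 * (q - p) = q * s - p * r\<close>; hence the sum telescopes.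
\<close>

lemma midpoint_step_sums_telescope:
  assumes x: "is_partition a b n x"
  shows "step_sum a b \<beta> n x (mid a b x \<alpha>) (midpoint_step a b n x \<alpha>) +
      step_sum a b \<alpha> n x (mid a b x \<beta>) (midpoint_step a b n x \<beta>) =
    \<alpha> b * \<beta> b - \<alpha> a * \<beta> a + (\<Sum>i=0..n. parts_correction a b \<alpha> \<beta> (x i))"
proof -
  define L where "L i = left_lim a \<alpha> (x i) * left_lim a \<beta> (x i)" for i
  define R where "R i = right_lim b \<alpha> (x i) * right_lim b \<beta> (x i)" for i
  have pt: "midpoint_step a b n x \<alpha> (x i) * mu_point a b \<beta> (x i) + midpoint_step a b n x \<beta> (x i) * mu_point a b \<alpha> (x i)
      = parts_correction a b \<alpha> \<beta> (x i) + (R i - L i)" if "i \<in> {0..n}" for i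
    using that by (simp add: midpoint_step_point parts_correction_def mu_point_def L_def R_def field_simps)
  have op: "mid a b x \<alpha> i * mu_open a b \<beta> (x (i - 1)) (x i) + mid a b x \<beta> i * mu_open a b \<alpha> (x (i - 1)) (x i)
      = L i - R (i - 1)" for i
    by (simp add: mid_def mu_open_def L_def R_def field_simps)
  have tel: "(\<Sum>i=0..k. R i - L i) + (\<Sum>i=1..k. L i - R (i - 1)) = R k - L 0" for k
    by (induction k) auto
  have "step_sum a b \<beta> n x (mid a b x \<alpha>) (midpoint_step a b n x \<alpha>) +
      step_sum a b \<alpha> n x (mid a b x \<beta>) (midpoint_step a b n x \<beta>) =
      (\<Sum>i=0..n. midpoint_step a b n x \<alpha> (x i) * mu_point a b \<beta> (x i) + midpoint_step a b n x \<beta> (x i) * mu_point a b \<alpha> (x i)) +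
      (\<Sum>i=1..n. mid a b x \<alpha> i * mu_open a b \<beta> (x (i - 1)) (x i) + mid a b x \<beta> i * mu_open a b \<alpha> (x (i - 1)) (x i))"
    by (simp add: step_sum_def sum.distrib)
  also have "\<dots> = (\<Sum>i=0..n. parts_correction a b \<alpha> \<beta> (x i) + (R i - L i)) + (\<Sum>i=1..n. L i - R (i - 1))"
    unfolding op by (simp only: pt cong: sum.cong)
  also have "\<dots> = (\<Sum>i=0..n. parts_correction a b \<alpha> \<beta> (x i)) + (R n - L 0)"
    unfolding sum.distrib tel[of n, symmetric] by simp
  \<comment> \<open>The conventions at \<open>a\<close> and \<open>b\<close> turn the two surviving
    products of limits into products of values.\<close>
  also have "R n - L 0 = \<alpha> b * \<beta> b - \<alpha> a * \<beta> a"
    using x by (simp add: is_partition_def L_def R_def left_lim_def right_lim_def)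
  finally show ?thesis by simp
qed

theorem theorem7p16:
  fixes a b :: real and \<alpha> \<beta> :: "real \<Rightarrow> real"
  assumes "a < b"
    and "bounded_variation_on a b \<alpha>"
    and "bounded_variation_on a b \<beta>"
  shows "RDS_integrable a b \<beta> \<alpha> \<and> RDS_integrable a b \<alpha> \<beta> \<and>
    parts_correction a b \<alpha> \<beta> summable_on common_discontinuities a b \<alpha> \<beta> \<and>
    RDS_integral a b \<beta> \<alpha> + RDS_integral a b \<alpha> \<beta> =
      \<alpha> b * \<beta> b - \<alpha> a * \<beta> a +
      (\<Sum>\<^sub>\<infinity>t\<in>common_discontinuities a b \<alpha> \<beta>. parts_correction a b \<alpha> \<beta> t)"
proof -
  let ?S = "common_discontinuities a b \<alpha> \<beta>" and ?A = "parts_correction a b \<alpha> \<beta>"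
  \<comment> \<open>The value that the sum must have. Proving \<open>has_sum\<close> with this value
    yields summability and the formula together.\<close>
  define D where "D = RDS_integral a b \<beta> \<alpha> + RDS_integral a b \<alpha> \<beta> - (\<alpha> b * \<beta> b - \<alpha> a * \<beta> a)"
  have sl: "sided_limits (extend a b \<alpha>)" "sided_limits (extend a b \<beta>)"
    using assms by (auto intro: bounded_variation_sided_limits)
  obtain K1 where K1: "0 \<le> K1" "\<And>n x c u \<epsilon>. step_repr a b n x c u \<Longrightarrow> \<forall>t\<in>{a..b}. \<bar>\<alpha> t - u t\<bar> \<le> \<epsilon>
      \<Longrightarrow> \<bar>RDS_integral a b \<beta> \<alpha> - step_sum a b \<beta> n x c u\<bar> \<le> \<epsilon> * K1"
    using RDS_integral_close[OF assms(3,2,1)] by blast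
  obtain K2 where K2: "0 \<le> K2" "\<And>n x c u \<epsilon>. step_repr a b n x c u \<Longrightarrow> \<forall>t\<in>{a..b}. \<bar>\<beta> t - u t\<bar> \<le> \<epsilon>
      \<Longrightarrow> \<bar>RDS_integral a b \<alpha> \<beta> - step_sum a b \<alpha> n x c u\<bar> \<le> \<epsilon> * K2"
    using RDS_integral_close[OF assms(2,3,1)] by blast
  have "(?A has_sum D) ?S"
    unfolding has_sum_def
  proof (rule tendstoI)
    fix r :: real assume "0 < r"
    \<comment> \<open>The added 1 keeps the denominator positive when both constants vanish and
      makes the final inequality strict.\<close>
    define \<epsilon> where "\<epsilon> = r / (K1 + K2 + 1)"
    have "0 < \<epsilon>" using \<open>0 < r\<close> K1(1) K2(1) by (simp add: \<epsilon>_def)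
    have "\<epsilon> * (K1 + K2) < r"
      using \<open>0 < r\<close> K1(1) K2(1) by (simp add: \<epsilon>_def field_simps)
    obtain P where P: "finite P" "\<And>s t. a \<le> s \<Longrightarrow> s \<le> t \<Longrightarrow> t \<le> b \<Longrightarrow> {s..t} \<inter> P = {}
        \<Longrightarrow> \<bar>extend a b \<alpha> s - extend a b \<alpha> t\<bar> \<le> \<epsilon>"
      using small_oscillation_off_finite_set[OF less_imp_le[OF assms(1)] sl(1) \<open>0 < \<epsilon>\<close>] by blast
    obtain Q where Q: "finite Q" "\<And>s t. a \<le> s \<Longrightarrow> s \<le> t \<Longrightarrow> t \<le> b \<Longrightarrow> {s..t} \<inter> Q = {}
        \<Longrightarrow> \<bar>extend a b \<beta> s - extend a b \<beta> t\<bar> \<le> \<epsilon>"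
      using small_oscillation_off_finite_set[OF less_imp_le[OF assms(1)] sl(2) \<open>0 < \<epsilon>\<close>] by blast
    define F where "F = {a, b} \<union> ((P \<union> Q) \<inter> {a..b})"
    have F: "finite F" "F \<subseteq> {a..b}" using P(1) Q(1) assms(1) by (auto simp: F_def)
    show "\<forall>\<^sub>F Y in finite_subsets_at_top ?S. dist (sum ?A Y) D < r"
      unfolding eventually_finite_subsets_at_top
    \<comment> \<open>The threshold must be a subset of the common discontinuities, so
      \<open>F\<close> is intersected with them; the rest of \<open>F\<close> returns in the
      partition through \<open>F \<union> Y\<close>.\<close>
    proof (intro exI[of _ "F \<inter> ?S"] conjI allI impI; (elim conjE)?)
      fix Y assume Y: "finite Y" "F \<inter> ?S \<subseteq> Y" "Y \<subseteq> ?S"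
      have "Y \<subseteq> {a..b}" using Y(3) by (auto simp: common_discontinuities_def)
      with F Y(1) have FY: "finite (F \<union> Y)" "F \<union> Y \<subseteq> {a..b}" "a \<in> F \<union> Y" "b \<in> F \<union> Y"
        by (auto simp: F_def)
      obtain n x where x: "is_partition a b n x" and img: "x ` {0..n} = F \<union> Y"
        using partition_of_finite_set[OF FY] .
      have off: "{s..t} \<inter> P = {}" "{s..t} \<inter> Q = {}"
        if "a \<le> s" "t \<le> b" "{s..t} \<inter> x ` {0..n} = {}" for s t
      proof -
        have "(P \<union> Q) \<inter> {a..b} \<subseteq> x ` {0..n}" "{s..t} \<subseteq> {a..b}" using that img by (auto simp: F_def)
        then show "{s..t} \<inter> P = {}" "{s..t} \<inter> Q = {}" using that(3) by blast+
      qed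
      have "\<bar>\<alpha> t - midpoint_step a b n x \<alpha> t\<bar> \<le> \<epsilon>" if "t \<in> {a..b}" for t
      proof (rule midpoint_step_close[OF x sl(1) assms(1) _ _ that])
        show "\<bar>\<alpha> s - \<alpha> t\<bar> \<le> \<epsilon>" if "a \<le> s" "s \<le> t" "t \<le> b" "{s..t} \<inter> x ` {0..n} = {}" for s t
          using P(2)[OF that(1-3) off(1)] that by simp
      qed (use \<open>0 < \<epsilon>\<close> in simp)
      then have 1: "\<bar>RDS_integral a b \<beta> \<alpha> - step_sum a b \<beta> n x (mid a b x \<alpha>) (midpoint_step a b n x \<alpha>)\<bar> \<le> \<epsilon> * K1"
        by (intro K1(2) midpoint_step_repr x ballI)
      have "\<bar>\<beta> t - midpoint_step a b n x \<beta> t\<bar> \<le> \<epsilon>" if "t \<in> {a..b}" for t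
      proof (rule midpoint_step_close[OF x sl(2) assms(1) _ _ that])
        show "\<bar>\<beta> s - \<beta> t\<bar> \<le> \<epsilon>" if "a \<le> s" "s \<le> t" "t \<le> b" "{s..t} \<inter> x ` {0..n} = {}" for s t
          using Q(2)[OF that(1-3) off(2)] that by simp
      qed (use \<open>0 < \<epsilon>\<close> in simp)
      then have 2: "\<bar>RDS_integral a b \<alpha> \<beta> - step_sum a b \<alpha> n x (mid a b x \<beta>) (midpoint_step a b n x \<beta>)\<bar> \<le> \<epsilon> * K2"
        by (intro K2(2) midpoint_step_repr x ballI)
      have "(\<Sum>i=0..n. ?A (x i)) = sum ?A (F \<union> Y)"
        unfolding img[symmetric] using partition_inj_on[OF x] by (simp add: sum.reindex)
      \<comment> \<open>A point of \<open>F\<close> outside \<open>Y\<close> cannot be a common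
        discontinuity, since \<open>Y\<close> contains all of those in \<open>F\<close>; its
        correction term is zero.\<close>
      also have "\<dots> = sum ?A Y"
      proof (rule sum.mono_neutral_right)
        show "\<forall>t\<in>(F \<union> Y) - Y. ?A t = 0"
          using F(2) Y parts_correction_eq_0[OF sl assms(1)] by blast
      qed (use F Y in auto)
      finally have "\<bar>D - sum ?A Y\<bar> \<le> \<epsilon> * (K1 + K2)"
        using 1 2 midpoint_step_sums_telescope[OF x, of \<beta> \<alpha>] unfolding D_def distrib_left by linarith
      with \<open>\<epsilon> * (K1 + K2) < r\<close> show "dist (sum ?A Y) D < r" by (simp add: dist_real_def abs_minus_commute)
    qed (use F in auto)
  qed
  then have "?A summable_on ?S" "infsum ?A ?S = D"
    by (auto simp: summable_on_def dest: infsumI)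
  moreover have "RDS_integrable a b \<beta> \<alpha>"
    using bounded_variation_RDS_decomp[OF assms(3,2,1)] assms(3) unfolding RDS_integrable_def by blast
  moreover have "RDS_integrable a b \<alpha> \<beta>"
    using bounded_variation_RDS_decomp[OF assms(2,3,1)] assms(2) unfolding RDS_integrable_def by blast
  ultimately show ?thesis by (simp add: D_def)
qed

end
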